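(* Let $n\ge 1$ and $0\le k\le n-1$. Let $\mathcal{P}(n+k-1,k)$ be the set of partial matchings of $[n+k-1]$ with exactly $k$ arcs that contain no $2$-right crossings and no right nestings. Let $\mathcal{S}(n,k)$ be the set of integer sequences $x=x_0x_1\ldots x_{n-1}$ with exactly $n-k$ left-to-right maxima such that (1) $x_0=0$; (2) for all $1\le i\le n-1$, $0\le x_i\le \max(x_0,x_1,\ldots,x_{i-1})+1$; (3) for all $1\le i\le n-1$, if $0\le x_i<\max(x_0,x_1,\ldots,x_{i-1})$, then $x_i<x_{i-1}$. Then there exists a bijection between $\mathcal{P}(n+k-1,k)$ and $\mathcal{S}(n,k)$.
   Context: $[m]=\{1,2,\ldots,m\}$, with $[0]=\emptyset$ (which has exactly one partition, the empty one). A partial matching of $[m]$ is a set partition of $[m]$ in which every block has at most two elements; each two-element block $\{i,j\}$ with $i<j$ is called an arc and written $(i,j)$. A right nesting is a pair of arcs $(i_1,j_1)$, $(i_2,j_2)$ with $i_1<i_2<j_2<j_1$ and $j_1=j_2+1$. A $2$-right crossing is a pair of arcs $(i_1,j_1)$, $(i_2,j_2)$ with $i_1<i_2<j_1<j_2$ and $j_2-j_1\le 2$. An entry $x_i$ of a sequence $x_0x_1\ldots x_{n-1}$ is a left-to-right maximum if it is strictly greater than all entries preceding it; the first entry $x_0$ is always counted as a left-to-right maximum. *)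

theory Defs
  imports Main "HOL-Library.Disjoint_Sets"
begin

definition partial_matching :: "nat \<Rightarrow> nat set set \<Rightarrow> bool" where
  "partial_matching m M \<longleftrightarrow> partition_on {1..m} M \<and> (\<forall>B\<in>M. card B \<le> 2)"

definition arcs :: "nat set set \<Rightarrow> (nat \<times> nat) set" where
  "arcs M = {(i, j). i < j \<and> {i, j} \<in> M}"

definition has_right_nesting :: "nat set set \<Rightarrow> bool" where
  "has_right_nesting M \<longleftrightarrow>
     (\<exists>i1 j1 i2 j2. (i1, j1) \<in> arcs M \<and> (i2, j2) \<in> arcs M \<and>
        i1 < i2 \<and> i2 < j2 \<and> j2 < j1 \<and> j1 = j2 + 1)"

definition has_2_right_crossing :: "nat set set \<Rightarrow> bool" where
  "has_2_right_crossing M \<longleftrightarrow>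
     (\<exists>i1 j1 i2 j2. (i1, j1) \<in> arcs M \<and> (i2, j2) \<in> arcs M \<and>
        i1 < i2 \<and> i2 < j1 \<and> j1 < j2 \<and> j2 - j1 \<le> 2)"

text \<open>The first argument of \<open>restricted_matchings\<close> is the size of the ground set, so the set
  \<open>P(n+k-1,k)\<close> is \<open>restricted_matchings (n + k - 1) k\<close>.\<close>

definition restricted_matchings :: "nat \<Rightarrow> nat \<Rightarrow> nat set set set" where
  "restricted_matchings m k =
     {M. partial_matching m M \<and> card (arcs M) = k \<and>
         \<not> has_2_right_crossing M \<and> \<not> has_right_nesting M}"

definition ltr_maxima :: "int list \<Rightarrow> nat set" where
  "ltr_maxima x = {i. i < length x \<and> (\<forall>j<i. x ! j < x ! i)}"

definition prefix_max :: "int list \<Rightarrow> nat \<Rightarrow> int" where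
  "prefix_max x i = Max {x ! j |j. j < i}"

text \<open>In \<open>restricted_sequences n k\<close> the parameter \<open>k\<close> counts the entries that are not
  left-to-right maxima.\<close>

definition restricted_sequences :: "nat \<Rightarrow> nat \<Rightarrow> int list set" where
  "restricted_sequences n k =
     {x. length x = n \<and> card (ltr_maxima x) = n - k \<and>
         x ! 0 = 0 \<and>
         (\<forall>i\<in>{1..n - 1}. 0 \<le> x ! i \<and> x ! i \<le> prefix_max x i + 1) \<and>
         (\<forall>i\<in>{1..n - 1}. 0 \<le> x ! i \<and> x ! i < prefix_max x i \<longrightarrow> x ! i < x ! (i - 1))}"

end

theory Submission
  imports Defs "HOL-Computational_Algebra.Polynomial"
begin

text \<open>
  Both sides are counted by transfer recurrences solved by the same explicit series. Let \<open>q\<close> mark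
  arcs (on the sequence side: entries that are not left-to-right maxima) and \<open>y\<close> mark singletons
  (left-to-right maxima after the first), and put \<open>t = 1 + q\<close>.

  Scan a matching from left to right. Right after a closer the possible continuations depend only
  on the number \<open>p\<close> of arcs still open and on the number \<open>r\<close> of these that opened before the arc just
  closed: two closers are never adjacent, and a closer two steps later must close an arc opened
  even earlier, or one opened in between. The resulting recurrences are solved by
  \<open>V(p,r) = \<Sum>m. a\<^sub>m c\<^sub>m\<^sup>p\<^sup>-\<^sup>r c\<^sub>m\<^sub>+\<^sub>1\<^sup>r\<close>, where \<open>c\<^sub>0 = 0\<close>, \<open>c\<^sub>m\<^sub>+\<^sub>1 = t c\<^sub>m + y\<close> and
  \<open>a\<^sub>m = \<Prod>j=1..m. (q + y t\<^sup>j)\<close>. The continuations of a sequence with maximum \<open>m\<close> and last entry \<open>l\<close>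
  have the series \<open>\<Sum>j. a\<^sub>j t\<^sup>m\<^sup>j\<^sup>+\<^sup>l\<close>. From the initial states both series equal \<open>\<Sum>m. a\<^sub>m\<close>.
\<close>

section \<open>Generating functions\<close>

text \<open>All series are cut off at \<open>m = M\<close>. This makes the recurrences exact polynomial identities up to
  a multiple of \<open>weight (Suc M)\<close>, which has no terms of total degree at most \<open>M\<close>.
  In the notation above, \<open>weight m\<close> is \<open>a\<^sub>m\<close>, \<open>slot m\<close> is \<open>c\<^sub>m\<close> and \<open>closed_gf\<close> is \<open>V\<close>.\<close>

context
  fixes q y :: "'a :: comm_ring_1"
begin

definition weight :: "nat \<Rightarrow> 'a" where
  "weight m = (\<Prod>j=1..m. q + y * (1 + q) ^ j)"

primrec slot :: "nat \<Rightarrow> 'a" where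
  "slot 0 = 0"
| "slot (Suc m) = (1 + q) * slot m + y"

definition seq_gf :: "nat \<Rightarrow> nat \<Rightarrow> nat \<Rightarrow> 'a" where
  "seq_gf M m l = (\<Sum>j\<le>M. weight j * (1 + q) ^ (m * j + l))"

definition closed_gf :: "nat \<Rightarrow> nat \<Rightarrow> nat \<Rightarrow> 'a" where
  "closed_gf M p r = (\<Sum>m\<le>M. weight m * slot m ^ (p - r) * slot (Suc m) ^ r)"

text \<open>The series for positions where the next letter, if it is a closer, may close any open arc.\<close>

definition free_gf :: "nat \<Rightarrow> nat \<Rightarrow> 'a" where
  "free_gf M p = closed_gf M p p + (\<Sum>r<p. closed_gf M (p - 1) r)"

section \<open>Recurrences of the truncated series\<close>

lemma weight_0 [simp]: "weight 0 = 1"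
  by (simp add: weight_def)

lemma weight_Suc: "weight (Suc m) = weight m * (q + y * (1 + q) ^ Suc m)"
  by (simp add: weight_def)

text \<open>Division-free form of \<open>slot m = y * ((1 + q) ^ m - 1) / q\<close>. It trades the
  powers of \<open>1 + q\<close> in \<open>weight\<close> for slots.\<close>

lemma slot_geometric: "q * slot m + y = y * (1 + q) ^ m"
proof (induction m)
  case (Suc m)
  have "q * slot (Suc m) + y = (1 + q) * (q * slot m + y)"
    by (simp add: algebra_simps)
  also have "\<dots> = y * (1 + q) ^ Suc m"
    by (simp only: Suc.IH power_Suc mult.left_commute)
  finally show ?case .
qed simp

lemma weight_Suc_slot: "weight (Suc m) = weight m * (q * slot (Suc m) + q + y)"
  by (simp only: weight_Suc slot_geometric[symmetric] ac_simps)

lemma sum_shift: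
  fixes f :: "nat \<Rightarrow> 'a"
  shows "(\<Sum>m\<le>M. f m) + f (Suc M) = f 0 + (\<Sum>m\<le>M. f (Suc m))"
  using sum.atMost_Suc_shift[of f M] by simp

text \<open>Shifting the index and splitting the factor \<open>q + y * (1 + q) ^ Suc j\<close> of
  \<open>weight (Suc j)\<close> gives the two series on the right. The term with
  \<open>weight (Suc M)\<close> is the price of the cut-off.\<close>

lemma seq_gf_0:
  "seq_gf M m 0 + weight (Suc M) * (1 + q) ^ (m * Suc M) =
     1 + y * seq_gf M (Suc m) (Suc m) + q * seq_gf M m m"
proof -
  have "weight (Suc j) * (1 + q) ^ (m * Suc j) =
      y * (weight j * (1 + q) ^ (Suc m * j + Suc m)) + q * (weight j * (1 + q) ^ (m * j + m))" for j
    by (simp add: weight_Suc algebra_simps power_add)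
  then show ?thesis
    using sum_shift[of "\<lambda>j. weight j * (1 + q) ^ (m * j)" M]
    by (simp add: seq_gf_def sum.distrib sum_distrib_left add.assoc del: mult_Suc mult_Suc_right)
qed

lemma seq_gf_Suc: "seq_gf M m (Suc l) = (1 + q) * seq_gf M m l"
  by (simp add: seq_gf_def sum_distrib_left algebra_simps)

text \<open>This is the geometric sum for \<open>(1 + q) ^ l\<close>, written without division by
  \<open>q\<close>.\<close>

lemma seq_gf_sum: "seq_gf M m l = seq_gf M m 0 + q * (\<Sum>v<l. seq_gf M m v)"
  by (induction l) (simp_all add: seq_gf_Suc algebra_simps)

text \<open>Read combinatorially: stop, append the new maximum \<open>m + 1\<close>, or append
  \<open>m\<close> or some \<open>v < l\<close>.\<close>

lemma seq_gf_rec: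
  "seq_gf M m l + weight (Suc M) * (1 + q) ^ (m * Suc M) =
     1 + y * seq_gf M (Suc m) (Suc m) + q * (seq_gf M m m + (\<Sum>v<l. seq_gf M m v))"
  using seq_gf_0[of M m] by (subst seq_gf_sum) (simp add: algebra_simps)

text \<open>Raising \<open>r\<close> replaces one factor \<open>slot m\<close> by
  \<open>(1 + q) * slot m + y\<close>; the summand \<open>y\<close> loses that factor, so
  \<open>p\<close> drops by one.\<close>

lemma closed_gf_Suc:
  assumes "r < p"
  shows "closed_gf M p (Suc r) = (1 + q) * closed_gf M p r + y * closed_gf M (p - 1) r"
proof -
  obtain d where d: "p - r = Suc d" "p - Suc r = d" "p - 1 - r = d"
    using assms by (metis Suc_diff_Suc diff_Suc_eq_diff_pred diff_commute)
  show ?thesis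
    by (simp add: closed_gf_def d sum_distrib_left sum.distrib[symmetric])
       (rule sum.cong, simp_all add: algebra_simps)
qed

text \<open>An index shift turns \<open>slot m\<close> into \<open>slot (Suc m)\<close>, hence
  \<open>r = 0\<close> into \<open>r = p\<close>. The summand at \<open>m = 0\<close> is
  \<open>0 ^ p\<close>, as \<open>slot 0 = 0\<close>: scanning may stop only when no arc is
  open.\<close>

lemma closed_gf_0:
  "closed_gf M p 0 + weight (Suc M) * slot (Suc M) ^ p =
     0 ^ p + q * closed_gf M (Suc p) (Suc p) + (q + y) * closed_gf M p p"
proof -
  have "weight (Suc m) * slot (Suc m) ^ p =
      q * (weight m * slot (Suc m) ^ Suc p) + (q + y) * (weight m * slot (Suc m) ^ p)" for m
    unfolding weight_Suc_slot by (simp add: algebra_simps)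
  then show ?thesis
    using sum_shift[of "\<lambda>m. weight m * slot m ^ p" M]
    by (simp add: closed_gf_def sum.distrib sum_distrib_left add.assoc del: slot.simps(2) power_Suc)
qed

lemma closed_gf_telescope:
  assumes "r \<le> p"
  shows "closed_gf M p p = closed_gf M p r
    + q * (\<Sum>s\<in>{r..<p}. closed_gf M p s) + y * (\<Sum>s\<in>{r..<p}. closed_gf M (p - 1) s)"
proof -
  have "closed_gf M p r' = closed_gf M p r
    + q * (\<Sum>s\<in>{r..<r'}. closed_gf M p s) + y * (\<Sum>s\<in>{r..<r'}. closed_gf M (p - 1) s)"
    if "r \<le> r'" "r' \<le> p" for r'
    using that
  proof (induction r' rule: dec_induct)
    case (step n)
    then show ?case by (simp add: closed_gf_Suc algebra_simps)
  qed simp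
  then show ?thesis using assms by blast
qed

lemma closed_gf_top:
  "closed_gf M p p + weight (Suc M) * slot (Suc M) ^ p =
     0 ^ p + q * free_gf M (Suc p) + y * free_gf M p"
  using closed_gf_0[of M p] closed_gf_telescope[of 0 p M]
  by (simp add: free_gf_def lessThan_atLeast0 algebra_simps)

text \<open>The terms on the right stand for stopping, an opener, a singleton, and a closer of the
  open arc with \<open>r\<close> earlier open arcs.\<close>

lemma free_gf_rec:
  "free_gf M p + weight (Suc M) * slot (Suc M) ^ p =
     0 ^ p + q * free_gf M (Suc p) + y * free_gf M p + (\<Sum>r<p. closed_gf M (p - 1) r)"
  using closed_gf_top[of M p] by (simp add: free_gf_def algebra_simps)

text \<open>The sums on the left are the forbidden continuations: an opener (\<open>q\<close>) or a
  singleton (\<open>y\<close>), followed by a closer of an arc that was already open and started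
  after the arc just closed.\<close>

lemma closed_gf_rec:
  assumes "r \<le> p"
  shows "closed_gf M p r + q * (\<Sum>s\<in>{r..<p}. closed_gf M p s)
      + y * (\<Sum>s\<in>{r..<p}. closed_gf M (p - 1) s) + weight (Suc M) * slot (Suc M) ^ p =
     0 ^ p + q * free_gf M (Suc p) + y * free_gf M p"
  using closed_gf_top[of M p] closed_gf_telescope[OF assms, of M] by simp

lemma free_gf_0_eq_seq_gf: "free_gf M 0 = seq_gf M 0 0"
  by (simp add: free_gf_def closed_gf_def seq_gf_def)

end

section \<open>Coefficients of polynomials in two variables\<close>

definition qvar :: "int poly poly" where "qvar = [:[:0, 1:]:]"
definition yvar :: "int poly poly" where "yvar = [:0, 1:]"

text \<open>The outer variable is \<open>yvar\<close> and the inner one \<open>qvar\<close>, so this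
  is the coefficient of \<open>qvar ^ a * yvar ^ b\<close>.\<close>

definition bcoeff :: "int poly poly \<Rightarrow> nat \<Rightarrow> nat \<Rightarrow> int" where
  "bcoeff P a b = coeff (coeff P b) a"

lemma bcoeff_add [simp]: "bcoeff (P + R) a b = bcoeff P a b + bcoeff R a b"
  by (simp add: bcoeff_def)

lemma bcoeff_sum [simp]: "bcoeff (sum f A) a b = (\<Sum>x\<in>A. bcoeff (f x) a b)"
  by (simp add: bcoeff_def coeff_sum)

lemma bcoeff_1 [simp]: "bcoeff 1 a b = (if a = 0 \<and> b = 0 then 1 else 0)"
  by (simp add: bcoeff_def)

lemma bcoeff_0 [simp]: "bcoeff 0 a b = 0"
  by (simp add: bcoeff_def)

lemma bcoeff_qvar [simp]: "bcoeff (qvar * P) a b = (if a = 0 then 0 else bcoeff P (a - 1) b)"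
  by (cases a) (simp_all add: bcoeff_def qvar_def)

lemma bcoeff_yvar [simp]: "bcoeff (yvar * P) a b = (if b = 0 then 0 else bcoeff P a (b - 1))"
  by (cases b) (simp_all add: bcoeff_def yvar_def)

text \<open>Each of the \<open>m\<close> factors of \<open>weight\<close> lacks a constant term. The
  multiplier \<open>R\<close> is arbitrary so that the induction can absorb the powers of
  \<open>1 + qvar\<close>; later it also absorbs the cofactors of the truncation errors.\<close>

lemma bcoeff_weight:
  "a + b < m \<Longrightarrow> bcoeff (weight qvar yvar m * R) a b = 0"
proof (induction m arbitrary: a b R)
  case (Suc m)
  have "weight qvar yvar (Suc m) * R = qvar * (weight qvar yvar m * R)
      + yvar * (weight qvar yvar m * ((1 + qvar) ^ Suc m * R))"
    by (simp only: weight_Suc) (simp add: algebra_simps)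
  then show ?case using Suc by (simp del: power_Suc)
qed simp

section \<open>Sequences\<close>

text \<open>Conditions (2) and (3) as a scan whose state is the maximum \<open>m\<close> so far and
  the previous entry \<open>l\<close>.\<close>

fun continues :: "int \<Rightarrow> int \<Rightarrow> int list \<Rightarrow> bool" where
  "continues m l [] \<longleftrightarrow> True"
| "continues m l (x # xs) \<longleftrightarrow>
     0 \<le> x \<and> x \<le> m + 1 \<and> (x < m \<longrightarrow> x < l) \<and> continues (max m x) x xs"

fun records :: "int \<Rightarrow> int list \<Rightarrow> nat" where
  "records m [] = 0"
| "records m (x # xs) = (if m < x then 1 else 0) + records (max m x) xs"

definition continuations :: "nat \<Rightarrow> nat \<Rightarrow> nat \<Rightarrow> nat \<Rightarrow> int list set" where
  "continuations m l a b =
     {xs. continues (int m) (int l) xs \<and> length xs = a + b \<and> records (int m) xs = b}"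

lemma records_le_length: "records m xs \<le> length xs"
  by (induction m xs rule: records.induct) auto

lemma continuations_0: "continuations m l 0 0 = {[]}"
  by (auto simp: continuations_def)

text \<open>The first entry is either the record \<open>m + 1\<close>, or it keeps the maximum
  \<open>m\<close> and is then \<open>m\<close> itself or below \<open>l\<close>.\<close>

lemma continuations_rec:
  assumes "0 < a + b" "l \<le> m"
  shows "continuations m l a b =
    (if b = 0 then {} else (#) (int (Suc m)) ` continuations (Suc m) (Suc m) a (b - 1)) \<union>
    (if a = 0 then {} else \<Union>v\<in>insert m {..<l}. (#) (int v) ` continuations m v (a - 1) b)"
    (is "?L = ?R")
proof (intro set_eqI iffI)
  fix xs assume xs: "xs \<in> ?L"
  with assms obtain x ys where xs_eq: "xs = x # ys"
    by (cases xs) (auto simp: continuations_def)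
  \<comment> \<open>If the first entry is not a record, all \<open>b\<close> records lie in
    \<open>ys\<close>, and this bound forces \<open>a\<close> to be nonzero.\<close>
  have r: "records (max (int m) x) ys \<le> length ys" by (rule records_le_length)
  consider "x = int (Suc m)" | v where "x = int v" "v \<in> insert m {..<l}"
  proof (cases "x > int m")
    case True
    with xs xs_eq that(1) show ?thesis by (auto simp: continuations_def)
  next
    case False
    with xs xs_eq have "0 \<le> x" "x = int m \<or> x < int l"
      by (auto simp: continuations_def)
    then show ?thesis by (intro that(2)[of "nat x"]) auto
  qed
  then show "xs \<in> ?R"
  proof cases
    case 1
    with xs r xs_eq show ?thesis
      by (auto simp: continuations_def max_def)
  next
    case 2
    then have "max (int m) x = int m" using assms by auto
    with xs r 2 assms have "a \<noteq> 0" and "ys \<in> continuations m v (a - 1) b"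
      by (auto simp: continuations_def xs_eq)
    with 2 show ?thesis by (auto simp: xs_eq)
  qed
next
  fix xs assume "xs \<in> ?R"
  with assms show "xs \<in> ?L"
    by (auto simp: continuations_def max_def split: if_splits)
qed

text \<open>Both sides obey the same recurrence, \<open>continuations_rec\<close> and
  \<open>seq_gf_rec\<close>; since \<open>a + b \<le> M\<close>, the truncation error does not reach
  this coefficient.\<close>

lemma card_continuations:
  assumes "l \<le> m" "a + b \<le> M"
  shows "finite (continuations m l a b) \<and>
    int (card (continuations m l a b)) = bcoeff (seq_gf qvar yvar M m l) a b"
  using assms
proof (induction "a + b" arbitrary: m l a b)
  case 0
  have "bcoeff (seq_gf qvar yvar M m l) 0 0 = 1"
    using arg_cong[OF seq_gf_rec[of qvar yvar M m l], of "\<lambda>P. bcoeff P 0 0"]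
    by (simp add: bcoeff_weight)
  with 0 show ?case by (simp add: continuations_0)
next
  case (Suc n)
  let ?X = "if b = 0 then {} else (#) (int (Suc m)) ` continuations (Suc m) (Suc m) a (b - 1)"
  let ?Y = "\<lambda>v. if a = 0 then {} else (#) (int v) ` continuations m v (a - 1) b"
  have eq: "continuations m l a b = ?X \<union> (\<Union>v\<in>insert m {..<l}. ?Y v)"
    using continuations_rec[of a b l m] Suc.hyps Suc.prems by (cases "a = 0") simp_all
  have X: "finite ?X \<and> int (card ?X) = bcoeff (yvar * seq_gf qvar yvar M (Suc m) (Suc m)) a b"
    using Suc.hyps(1)[of a "b - 1" "Suc m" "Suc m"] Suc.hyps(2) Suc.prems
    by (auto simp: card_image)
  have Y: "finite (?Y v) \<and> int (card (?Y v)) = bcoeff (qvar * seq_gf qvar yvar M m v) a b"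
    if "v \<le> m" for v
    using Suc.hyps(1)[of "a - 1" b v m] Suc.hyps(2) Suc.prems that
    by (auto simp: card_image)
  have Yl: "v \<le> m" if "v \<in> insert m {..<l}" for v using that Suc.prems by auto
  have "card (\<Union>v\<in>insert m {..<l}. ?Y v) = (\<Sum>v\<in>insert m {..<l}. card (?Y v))"
    using Y Yl by (intro card_UN_disjoint) auto
  moreover have "?X \<inter> (\<Union>v\<in>insert m {..<l}. ?Y v) = {}"
    using Suc.prems by auto
  moreover have fin: "finite (\<Union>v\<in>insert m {..<l}. ?Y v)"
    using Y Yl by (intro finite_UN_I) auto
  ultimately have "int (card (continuations m l a b)) =
      int (card ?X) + (\<Sum>v\<in>insert m {..<l}. int (card (?Y v)))"
    using X unfolding eq by (subst card_Un_disjoint) auto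
  also have "(\<Sum>v\<in>insert m {..<l}. int (card (?Y v))) =
      (\<Sum>v\<in>insert m {..<l}. bcoeff (qvar * seq_gf qvar yvar M m v) a b)"
    using Y Yl by (intro sum.cong) auto
  also have "\<dots> = bcoeff (qvar * (seq_gf qvar yvar M m m + (\<Sum>v<l. seq_gf qvar yvar M m v))) a b"
    using Suc.prems by simp
  also have "int (card ?X) + \<dots> = bcoeff (seq_gf qvar yvar M m l) a b"
    using arg_cong[OF seq_gf_rec[of qvar yvar M m l], of "\<lambda>P. bcoeff P a b"] X Suc.hyps(2) Suc.prems
    by (simp add: bcoeff_weight del: mult_Suc_right split: if_splits)
  finally show ?case using X fin eq by simp
qed

section \<open>From conditions on indices to the recursive scan\<close>

lemma prefix_max_eq: "i \<le> length x \<Longrightarrow> prefix_max x i = Max (set (take i x))"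
  unfolding prefix_max_def by (rule arg_cong[of _ _ Max]) (auto simp flip: nth_image)

text \<open>The prefix \<open>zs\<close> is general because the induction on \<open>ys\<close> moves
  one entry after another to its end.\<close>

lemma continues_iff:
  assumes "zs \<noteq> []"
  shows "(\<forall>i\<in>{length zs..<length (zs @ ys)}.
      0 \<le> (zs @ ys) ! i \<and> (zs @ ys) ! i \<le> prefix_max (zs @ ys) i + 1 \<and>
      ((zs @ ys) ! i < prefix_max (zs @ ys) i \<longrightarrow> (zs @ ys) ! i < (zs @ ys) ! (i - 1)))
    \<longleftrightarrow> continues (Max (set zs)) (last zs) ys"
  using assms
proof (induction ys arbitrary: zs)
  case (Cons y ys)
  have "{length zs..<length (zs @ y # ys)} =
      insert (length zs) {length (zs @ [y])..<length ((zs @ [y]) @ ys)}" by auto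
  moreover have "(zs @ y # ys) ! (length zs - 1) = last zs"
    using Cons.prems by (simp add: nth_append last_conv_nth)
  moreover have "Max (set (zs @ [y])) = max (Max (set zs)) y"
    using Cons.prems by (simp add: max.commute)
  ultimately show ?case
    using Cons.IH[of "zs @ [y]"] by (simp add: prefix_max_eq)
qed simp

lemma ltr_maxima_snoc:
  assumes "zs \<noteq> []"
  shows "ltr_maxima (zs @ [y]) =
    (if Max (set zs) < y then insert (length zs) (ltr_maxima zs) else ltr_maxima zs)"
proof -
  have "Max (set zs) < y \<longleftrightarrow> (\<forall>j<length zs. zs ! j < y)"
    using assms by (auto simp: all_set_conv_all_nth)
  then show ?thesis
    by (auto simp: ltr_maxima_def nth_append less_Suc_eq)
qed

lemma card_ltr_maxima_append:
  assumes "zs \<noteq> []"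
  shows "card (ltr_maxima (zs @ ys)) = card (ltr_maxima zs) + records (Max (set zs)) ys"
  using assms
proof (induction ys arbitrary: zs)
  case (Cons y ys)
  have "finite (ltr_maxima zs)" "length zs \<notin> ltr_maxima zs"
    by (auto simp: ltr_maxima_def)
  moreover have "Max (set (zs @ [y])) = max (Max (set zs)) y"
    using Cons.prems by (simp add: max.commute)
  ultimately show ?case
    using Cons.IH[of "zs @ [y]"] ltr_maxima_snoc[OF Cons.prems, of y] by simp
qed simp

text \<open>The leading 0 is itself a left-to-right maximum, so \<open>n - 1 - k\<close> records
  remain among the last \<open>n - 1\<close> entries.\<close>

lemma restricted_sequences_eq:
  assumes "n \<ge> 1" "k \<le> n - 1"
  shows "restricted_sequences n k = (#) 0 ` continuations 0 0 k (n - 1 - k)"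
proof -
  have "ltr_maxima [0] = {0}" by (auto simp: ltr_maxima_def)
  then have c: "card (ltr_maxima (0 # ys)) = Suc (records 0 ys)" for ys
    using card_ltr_maxima_append[of "[0]" ys] by simp
  have r: "{1..n - 1} = {1..<Suc (length ys)}" if "length ys = n - 1" for ys :: "int list"
    using that by auto
  have "0 # ys \<in> restricted_sequences n k \<longleftrightarrow> ys \<in> continuations 0 0 k (n - 1 - k)" for ys
  proof (cases "length ys = n - 1")
    case True
    then show ?thesis
      using continues_iff[of "[0]" ys] assms
      unfolding restricted_sequences_def continuations_def r[OF True] by (auto simp: c)
  next
    case False
    then show ?thesis
      using assms by (auto simp: restricted_sequences_def continuations_def)
  qed
  moreover have "\<exists>ys. x = 0 # ys" if "x \<in> restricted_sequences n k" for x
    using that assms by (cases x) (auto simp: restricted_sequences_def)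
  ultimately show ?thesis by blast
qed

section \<open>Completions of partial matchings\<close>

text \<open>Two arcs with adjacent closers always form a crossing or a right nesting.\<close>

definition right_avoiding :: "(nat \<times> nat) set \<Rightarrow> bool" where
  "right_avoiding E \<longleftrightarrow> (\<forall>a b a'. (a, b) \<in> E \<longrightarrow> (a', Suc b) \<notin> E) \<and>
     (\<forall>a b a'. (a, b) \<in> E \<longrightarrow> (a', Suc (Suc b)) \<in> E \<longrightarrow> a < a' \<longrightarrow> b \<le> a')"

text \<open>Sets of arcs that complete a matching of \<open>{1..N}\<close> from position \<open>j\<close> on: \<open>P\<close> holds the openers
  before \<open>j\<close> that still need a closer, \<open>u\<close> counts the openers and \<open>s\<close> the singletons from \<open>j\<close> on.\<close>

definition completions :: "nat \<Rightarrow> nat \<Rightarrow> nat set \<Rightarrow> nat \<Rightarrow> nat \<Rightarrow> (nat \<times> nat) set set" where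
  "completions N j P u s = {E.
     inj_on fst E \<and> inj_on snd E \<and> fst ` E \<inter> snd ` E = {} \<and>
     P \<subseteq> fst ` E \<and> fst ` E \<subseteq> P \<union> {j..N} \<and> snd ` E \<subseteq> {j..N} \<and>
     (\<forall>(a, b)\<in>E. a < b) \<and> right_avoiding E \<and>
     card (fst ` E - P) = u \<and> card ({j..N} - fst ` E - snd ` E) = s}"

text \<open>The completions allowed when \<open>j - 1\<close> closes an arc opened at \<open>i\<close>.\<close>

definition after_closer ::
  "nat \<Rightarrow> nat \<Rightarrow> nat set \<Rightarrow> nat \<Rightarrow> nat \<Rightarrow> nat \<Rightarrow> (nat \<times> nat) set set" where
  "after_closer N j P i u s = {E \<in> completions N j P u s.
     j \<notin> snd ` E \<and> (\<forall>a. (a, Suc j) \<in> E \<longrightarrow> i < a \<longrightarrow> j \<le> a)}"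

lemma completionsD:
  assumes "E \<in> completions N j P u s"
  shows "inj_on fst E" "inj_on snd E" "fst ` E \<inter> snd ` E = {}" "P \<subseteq> fst ` E"
    "fst ` E \<subseteq> P \<union> {j..N}" "snd ` E \<subseteq> {j..N}" "\<forall>(a, b)\<in>E. a < b" "right_avoiding E"
    "card (fst ` E - P) = u" "card ({j..N} - fst ` E - snd ` E) = s"
  using assms by (simp_all add: completions_def)

lemma finite_completions:
  assumes "finite P"
  shows "finite (completions N j P u s)"
proof (rule finite_subset)
  show "completions N j P u s \<subseteq> Pow ((P \<union> {j..N}) \<times> {j..N})"
  proof
    fix E assume E: "E \<in> completions N j P u s"
    have "E \<subseteq> fst ` E \<times> snd ` E" by (rule subset_fst_snd)
    also have "\<dots> \<subseteq> (P \<union> {j..N}) \<times> {j..N}"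
      using completionsD(5,6)[OF E] by (rule Sigma_mono)
    finally show "E \<in> Pow ((P \<union> {j..N}) \<times> {j..N})" by simp
  qed
qed (use assms in auto)

lemma completions_end:
  assumes "N < j"
  shows "completions N j {} 0 0 = {{}}" "after_closer N j {} i 0 0 = {{}}"
  using assms by (auto simp: completions_def after_closer_def right_avoiding_def)

section \<open>Decomposition by the role of position \<open>j\<close>\<close>

lemma completions_single:
  assumes "j \<le> N" "P \<subseteq> {..<j}"
  shows "{E \<in> completions N j P u s. j \<notin> fst ` E \<and> j \<notin> snd ` E} =
    (if s = 0 then {} else completions N (Suc j) P u (s - 1))"
proof -
  have j: "{j..N} = insert j {Suc j..N}" using assms by auto
  have "E \<in> completions N j P u s \<longleftrightarrow> s \<noteq> 0 \<and> E \<in> completions N (Suc j) P u (s - 1)"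
    if "j \<notin> fst ` E" "j \<notin> snd ` E" for E
  proof -
    have "card ({j..N} - fst ` E - snd ` E) = Suc (card ({Suc j..N} - fst ` E - snd ` E))"
      using that by (simp add: j insert_Diff_if)
    then have "card ({j..N} - fst ` E - snd ` E) = s \<longleftrightarrow>
        s \<noteq> 0 \<and> card ({Suc j..N} - fst ` E - snd ` E) = s - 1"
      by auto
    moreover have "fst ` E \<subseteq> P \<union> {j..N} \<longleftrightarrow> fst ` E \<subseteq> P \<union> {Suc j..N}"
      unfolding j Un_insert_right using that(1) by (rule subset_insert)
    moreover have "snd ` E \<subseteq> {j..N} \<longleftrightarrow> snd ` E \<subseteq> {Suc j..N}"
      unfolding j using that(2) by (rule subset_insert)
    ultimately show ?thesis
      unfolding completions_def mem_Collect_eq by argo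
  qed
  moreover have "j \<notin> fst ` E \<and> j \<notin> snd ` E" if "E \<in> completions N (Suc j) P u t" for E t
  proof -
    have "j \<notin> P \<union> {Suc j..N}" "j \<notin> {Suc j..N}" using assms by auto
    with completionsD(5,6)[OF that] show ?thesis by (metis subsetD)
  qed
  ultimately show ?thesis by (cases "s = 0")
    (simp_all only: if_True if_False not_False_eq_True not_True_eq_False simp_thms, blast+)
qed

text \<open>The opener \<open>j\<close> passes from the openers counted by \<open>u\<close> to the
  pending ones in \<open>insert j P\<close>.\<close>

lemma completions_opener:
  assumes "j \<le> N" "P \<subseteq> {..<j}"
  shows "{E \<in> completions N j P u s. j \<in> fst ` E} =
    (if u = 0 then {} else completions N (Suc j) (insert j P) (u - 1) s)"
proof -
  have j: "{j..N} = insert j {Suc j..N}" "j \<notin> P" using assms by auto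
  have "E \<in> completions N j P u s \<longleftrightarrow> u \<noteq> 0 \<and> E \<in> completions N (Suc j) (insert j P) (u - 1) s"
    if "j \<in> fst ` E" for E
  proof (cases "j \<in> snd ` E")
    case True
    with that have j: "j \<in> fst ` E \<inter> snd ` E" by (rule IntI)
    have "E \<notin> completions N j' P' u' s'" for j' P' u' s'
    proof
      assume "E \<in> completions N j' P' u' s'"
      from completionsD(3)[OF this] j show False by (simp only: empty_iff)
    qed
    then show ?thesis by (simp only: simp_thms)
  next
    case False
    have e1: "{j..N} - fst ` E - snd ` E = {Suc j..N} - fst ` E - snd ` E"
    proof -
      have "insert j K - A - B = K - A - B" if "j \<in> A" for A B K using that by blast
      from this[OF that] show ?thesis unfolding j(1) .
    qed
    have e2: "fst ` E \<subseteq> P \<union> {j..N} \<longleftrightarrow> fst ` E \<subseteq> insert j P \<union> {Suc j..N}"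
      by (simp add: j(1))
    have e3: "snd ` E \<subseteq> {j..N} \<longleftrightarrow> snd ` E \<subseteq> {Suc j..N}"
      unfolding j(1) using False by (rule subset_insert)
    have e4: "P \<subseteq> fst ` E \<longleftrightarrow> insert j P \<subseteq> fst ` E"
      using that by simp
    show ?thesis
    \<comment> \<open>The inclusion makes the set of new openers finite, so that removing
      \<open>j\<close> lowers its cardinality by one; if it fails, neither membership holds.\<close>
    proof (cases "fst ` E \<subseteq> P \<union> {j..N}")
      case True
      then have "fst ` E - P \<subseteq> {j..N}" by (simp only: Diff_subset_conv)
      then have "finite (fst ` E - P)" by (rule finite_subset) (rule finite_atLeastAtMost)
      then have "card (fst ` E - P) = Suc (card (fst ` E - insert j P))"
        unfolding Diff_insert[of "fst ` E" j P] by (rule card_Suc_Diff1[OF _ DiffI[OF that j(2)], symmetric])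
      then have "card (fst ` E - P) = u \<longleftrightarrow> u \<noteq> 0 \<and> card (fst ` E - insert j P) = u - 1"
        by (cases u) simp_all
      then show ?thesis unfolding completions_def mem_Collect_eq e1 e2 e3 e4 by argo
    next
      case False
      then show ?thesis unfolding completions_def mem_Collect_eq e2 by argo
    qed
  qed
  moreover have "j \<in> fst ` E" if "E \<in> completions N (Suc j) (insert j P) t s" for E t
    using completionsD(4)[OF that] by (metis insert_subset)
  ultimately show ?thesis by (cases "u = 0")
    (simp_all only: if_True if_False not_False_eq_True not_True_eq_False simp_thms, blast+)
qed

text \<open>All other closers come after \<open>j\<close>, so the new arc can only be the one with
  the smaller closer in a forbidden pair.\<close>

lemma right_avoiding_insert_iff:
  assumes "\<And>a b. (a, b) \<in> E \<Longrightarrow> j < b"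
  shows "right_avoiding (insert (i, j) E) \<longleftrightarrow> right_avoiding E \<and> Suc j \<notin> snd ` E \<and>
    (\<forall>a. (a, Suc (Suc j)) \<in> E \<longrightarrow> i < a \<longrightarrow> j \<le> a)"
proof -
  have "(a, Suc b) \<noteq> (i, j)" "(a, Suc (Suc b)) \<noteq> (i, j)" if "(c, b) \<in> E" for a b c
    using assms[OF that] by auto
  then show ?thesis unfolding right_avoiding_def by (auto simp: image_iff)
qed

text \<open>Removing the arc \<open>(i, j)\<close> leaves exactly the restrictions on the next two
  positions that \<open>after_closer\<close> records.\<close>

lemma completions_closer:
  assumes "j \<le> N" "P \<subseteq> {..<j}" "i \<in> P"
  shows "{E \<in> completions N j P u s. (i, j) \<in> E} =
    insert (i, j) ` after_closer N (Suc j) (P - {i}) i u s"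
proof -
  have j: "{j..N} = insert j {Suc j..N}" "j \<notin> P" "i < j" using assms by auto
  have set1: "insert i A \<subseteq> P \<union> insert j K \<longleftrightarrow> A \<subseteq> P - {i} \<union> K"
    if "i \<notin> A" "j \<notin> A" "i \<in> P" for A K using that by blast
  have set2: "insert j A \<subseteq> insert j K \<longleftrightarrow> A \<subseteq> K" if "j \<notin> A" for A K using that by blast
  have set3: "insert i A - P = A - (P - {i})" if "i \<notin> A" "i \<in> P" for A using that by blast
  have set4: "insert j K - insert i A - insert j B = K - A - B"
    if "i \<notin> K" "j \<notin> K" for A B K using that by blast
  have iff: "insert (i, j) E \<in> completions N j P u s \<longleftrightarrow>
      E \<in> after_closer N (Suc j) (P - {i}) i u s" if E: "(i, j) \<notin> E" for E
  \<comment> \<open>Either membership implies this condition. Under it the defining clauses can be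
    translated one by one.\<close>
  proof (cases "i \<notin> fst ` E \<and> j \<notin> snd ` E \<and> j \<notin> fst ` E \<and> i \<notin> snd ` E \<and> (\<forall>(a, b)\<in>E. j < b)")
    case True
    then have t: "i \<notin> fst ` E" "j \<notin> snd ` E" "j \<notin> fst ` E" "i \<notin> snd ` E" "\<forall>(a, b)\<in>E. j < b"
      by simp_all
    have g: "right_avoiding (insert (i, j) E) \<longleftrightarrow> right_avoiding E \<and> Suc j \<notin> snd ` E \<and>
        (\<forall>a. (a, Suc (Suc j)) \<in> E \<longrightarrow> i < a \<longrightarrow> j \<le> a)"
      using t(5) by (intro right_avoiding_insert_iff) fast
    \<comment> \<open>Since \<open>j\<close> opens no arc, the bound \<open>j \<le> a\<close>
      sharpens to \<open>Suc j \<le> a\<close>, the form used by \<open>after_closer\<close> at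
      position \<open>Suc j\<close>.\<close>
    have "a \<noteq> j" if "(a, b) \<in> E" for a b using t(3) that by force
    then have g': "(\<forall>a. (a, Suc (Suc j)) \<in> E \<longrightarrow> i < a \<longrightarrow> j \<le> a) \<longleftrightarrow>
        (\<forall>a. (a, Suc (Suc j)) \<in> E \<longrightarrow> i < a \<longrightarrow> Suc j \<le> a)"
      by (metis le_eq_less_or_eq Suc_le_eq)
    have e1: "inj_on fst (insert (i, j) E) \<longleftrightarrow> inj_on fst E"
      "inj_on snd (insert (i, j) E) \<longleftrightarrow> inj_on snd E"
      using t E by (simp_all add: inj_on_insert)
    have e2: "fst ` insert (i, j) E \<inter> snd ` insert (i, j) E = {} \<longleftrightarrow> fst ` E \<inter> snd ` E = {}"
      using t j(3) by simp
    have e3: "P \<subseteq> fst ` insert (i, j) E \<longleftrightarrow> P - {i} \<subseteq> fst ` E"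
      by (simp add: subset_insert_iff)
    have e4: "fst ` insert (i, j) E \<subseteq> P \<union> {j..N} \<longleftrightarrow> fst ` E \<subseteq> P - {i} \<union> {Suc j..N}"
      unfolding image_insert fst_conv j(1) using t(1,3) assms(3) by (rule set1)
    have e5: "snd ` insert (i, j) E \<subseteq> {j..N} \<longleftrightarrow> snd ` E \<subseteq> {Suc j..N}"
      unfolding image_insert snd_conv j(1) using t(2) by (rule set2)
    have e6: "(\<forall>(a, b)\<in>insert (i, j) E. a < b) \<longleftrightarrow> (\<forall>(a, b)\<in>E. a < b)"
      using j(3) by simp
    have e7: "fst ` insert (i, j) E - P = fst ` E - (P - {i})"
      unfolding image_insert fst_conv using t(1) assms(3) by (rule set3)
    have "i \<notin> {Suc j..N}" "j \<notin> {Suc j..N}" using j(3) by simp_all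
    then have e8: "{j..N} - fst ` insert (i, j) E - snd ` insert (i, j) E = {Suc j..N} - fst ` E - snd ` E"
      unfolding image_insert fst_conv snd_conv j(1) by (rule set4)
    show ?thesis
      unfolding completions_def after_closer_def mem_Collect_eq e1 e2 e3 e4 e5 e6 e7 e8 g g'
      by (rule iffI; elim conjE; intro conjI; assumption)
  next
    case False
    have "insert (i, j) E \<notin> completions N j P u s"
    proof
      assume "insert (i, j) E \<in> completions N j P u s"
      note D = completionsD[OF this]
      from D(1,2) E have "i \<notin> fst ` E" and jE: "j \<notin> snd ` E"
        by (simp_all add: inj_on_insert)
      moreover from D(3) have "j \<notin> fst ` E" "i \<notin> snd ` E" by simp_all
      moreover have "\<forall>(a, b)\<in>E. j < b"
      proof clarify
        fix a b assume "(a, b) \<in> E"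
        then have b: "b \<in> snd ` E" by force
        with jE have "b \<noteq> j" by metis
        moreover have "b \<in> {j..N}" using D(6) b by (simp add: subset_iff)
        ultimately show "j < b" by simp
      qed
      ultimately show False using False by argo
    qed
    moreover have "E \<notin> after_closer N (Suc j) (P - {i}) i u s"
    proof
      assume "E \<in> after_closer N (Suc j) (P - {i}) i u s"
      then have "E \<in> completions N (Suc j) (P - {i}) u s" by (simp add: after_closer_def)
      note D = completionsD[OF this]
      have "i \<notin> P - {i} \<union> {Suc j..N}" "j \<notin> P - {i} \<union> {Suc j..N}" using j(2,3) by auto
      with D(5) have "i \<notin> fst ` E" "j \<notin> fst ` E" by (metis subsetD)+
      moreover have "i \<notin> {Suc j..N}" "j \<notin> {Suc j..N}" using j(3) by auto
      with D(6) have "j \<notin> snd ` E" "i \<notin> snd ` E" by (metis subsetD)+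
      moreover have "\<forall>(a, b)\<in>E. j < b"
      proof clarify
        fix a b assume "(a, b) \<in> E"
        then have "b \<in> snd ` E" by force
        with D(6) have "b \<in> {Suc j..N}" by (rule subsetD)
        then show "j < b" by simp
      qed
      ultimately show False using False by argo
    qed
    ultimately show ?thesis by argo
  qed
  have nin: "(i, j) \<notin> E" if "E \<in> after_closer N (Suc j) (P - {i}) i u s" for E
  proof -
    have "snd ` E \<subseteq> {Suc j..N}" using that by (simp add: after_closer_def completions_def)
    moreover have "j \<notin> {Suc j..N}" by simp
    ultimately have "j \<notin> snd ` E" by (metis subsetD)
    then show ?thesis by force
  qed
  show ?thesis
  proof (intro set_eqI iffI)
    fix E assume E: "E \<in> {E \<in> completions N j P u s. (i, j) \<in> E}"
    then have "E = insert (i, j) (E - {(i, j)})" by (simp add: insert_absorb)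
    moreover have "E - {(i, j)} \<in> after_closer N (Suc j) (P - {i}) i u s"
      using E calculation iff[of "E - {(i, j)}"] by simp
    ultimately show "E \<in> insert (i, j) ` after_closer N (Suc j) (P - {i}) i u s"
      by (rule image_eqI)
  next
    fix E assume "E \<in> insert (i, j) ` after_closer N (Suc j) (P - {i}) i u s"
    then obtain E' where E': "E = insert (i, j) E'" "E' \<in> after_closer N (Suc j) (P - {i}) i u s"
      by blast
    with iff[OF nin[OF E'(2)]] show "E \<in> {E \<in> completions N j P u s. (i, j) \<in> E}" by simp
  qed
qed

section \<open>Ranks of open arcs, matching the parameter \<open>r\<close> of
  \<open>closed_gf\<close>\<close>

definition rank :: "nat set \<Rightarrow> nat \<Rightarrow> nat" where
  "rank P i = card {x \<in> P. x < i}"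

lemma rank_mono: "finite P \<Longrightarrow> i \<le> a \<Longrightarrow> rank P i \<le> rank P a"
  unfolding rank_def by (intro card_mono) auto

lemma rank_strict_mono: "finite P \<Longrightarrow> a \<in> P \<Longrightarrow> a < i \<Longrightarrow> rank P a < rank P i"
  unfolding rank_def by (intro psubset_card_mono) auto

lemma rank_le_card: "finite P \<Longrightarrow> rank P i \<le> card P"
  unfolding rank_def by (intro card_mono) auto

lemma rank_less_card: "finite P \<Longrightarrow> a \<in> P \<Longrightarrow> rank P a < card P"
  unfolding rank_def by (intro psubset_card_mono) auto

lemma rank_Diff_self: "rank (P - {a}) a = rank P a"
  unfolding rank_def by (rule arg_cong[of _ _ card]) auto

lemma rank_insert_above: "a \<le> j \<Longrightarrow> rank (insert j P) a = rank P a"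
  unfolding rank_def by (rule arg_cong[of _ _ card]) auto

lemma bij_betw_rank:
  assumes "finite P"
  shows "bij_betw (rank P) P {..<card P}"
proof -
  have inj: "inj_on (rank P) P"
  proof (rule inj_onI)
    fix a b assume "a \<in> P" "b \<in> P" "rank P a = rank P b"
    then show "a = b"
      using rank_strict_mono[OF assms, of a b] rank_strict_mono[OF assms, of b a]
      by (cases a b rule: linorder_cases) auto
  qed
  moreover have "rank P ` P = {..<card P}"
    using rank_less_card[OF assms] card_image[OF inj]
    by (intro card_subset_eq) auto
  ultimately show ?thesis by (simp add: bij_betw_def)
qed

lemma sum_rank:
  assumes "finite P"
  shows "(\<Sum>a\<in>P. f (rank P a)) = (\<Sum>r<card P. f r)"
  by (rule sum.reindex_bij_betw[OF bij_betw_rank[OF assms]])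

text \<open>Because \<open>i\<close> is not in \<open>P\<close>, an opener lies above
  \<open>i\<close> exactly when its rank is at least \<open>rank P i\<close>. This produces the sums
  in \<open>closed_gf_rec\<close>.\<close>

lemma sum_rank_above:
  assumes "finite P" "i \<notin> P"
  shows "(\<Sum>a\<in>{a \<in> P. i < a}. f (rank P a)) = (\<Sum>r\<in>{rank P i..<card P}. f r)"
proof (rule sum.reindex_bij_betw)
  have iff: "rank P i \<le> rank P a \<longleftrightarrow> i < a" if "a \<in> P" for a
  proof
    assume "rank P i \<le> rank P a"
    with rank_strict_mono[OF assms(1) that, of i] that assms(2) show "i < a"
      by (cases a i rule: linorder_cases) auto
  next
    assume "i < a" then show "rank P i \<le> rank P a" using rank_mono[OF assms(1)] by simp
  qed
  note b = bij_betw_rank[OF assms(1)]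
  have im: "rank P ` P = {..<card P}" using b by (rule bij_betw_imp_surj_on)
  have "rank P ` {a \<in> P. i < a} = {rank P i..<card P}"
  proof
    show "rank P ` {a \<in> P. i < a} \<subseteq> {rank P i..<card P}"
      using iff rank_less_card[OF assms(1)] by auto
    show "{rank P i..<card P} \<subseteq> rank P ` {a \<in> P. i < a}"
    proof
      fix r assume r: "r \<in> {rank P i..<card P}"
      then have "r \<in> rank P ` P" unfolding im by simp
      then obtain a where "a \<in> P" "r = rank P a" by blast
      with r iff show "r \<in> rank P ` {a \<in> P. i < a}" by auto
    qed
  qed
  then show "bij_betw (rank P) {a \<in> P. i < a} {rank P i..<card P}"
    using b by (metis (no_types, lifting) bij_betw_subset mem_Collect_eq subsetI)
qed

text \<open>Position \<open>j\<close> closes at most one arc, so the choices of its opener are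
  disjoint cases. The alternative \<open>Q = {}\<close> allows \<open>j\<close> to lie beyond the
  last position.\<close>

lemma card_closers:
  assumes "j \<le> N \<or> Q = {}" "P \<subseteq> {..<j}" "Q \<subseteq> P" "finite P"
  shows "card {E \<in> completions N j P u s. \<exists>a\<in>Q. (a, j) \<in> E} =
    (\<Sum>a\<in>Q. card (after_closer N (Suc j) (P - {a}) a u s))"
proof (cases "Q = {}")
  case False
  let ?S = "\<lambda>a. {E \<in> completions N j P u s. (a, j) \<in> E}"
  have fin: "finite Q" using assms by (metis finite_subset)
  have "card (?S a) = card (after_closer N (Suc j) (P - {a}) a u s)" if "a \<in> Q" for a
  proof -
    have "(a, j) \<notin> E" if "E \<in> after_closer N (Suc j) (P - {a}) a u s" for E
    proof -
      from that have "E \<in> completions N (Suc j) (P - {a}) u s" by (simp add: after_closer_def)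
      from completionsD(6)[OF this] show ?thesis
        by (metis Suc_n_not_le_n atLeastAtMost_iff image_eqI snd_conv subsetD)
    qed
    then have "inj_on (insert (a, j)) (after_closer N (Suc j) (P - {a}) a u s)"
      by (metis inj_onI insert_ident)
    then show ?thesis
      using completions_closer[of j N P a u s] assms False that by (simp add: card_image subset_eq)
  qed
  moreover have "card (\<Union>a\<in>Q. ?S a) = (\<Sum>a\<in>Q. card (?S a))"
  proof (rule card_UN_disjoint[OF fin])
    show "\<forall>a\<in>Q. finite (?S a)" using finite_completions[OF assms(4)] by simp
    have "a = a'" if "E \<in> ?S a" "E \<in> ?S a'" for a a' E
    proof -
      have "inj_on snd E" "(a, j) \<in> E" "(a', j) \<in> E" using that completionsD(2) by auto
      then show ?thesis by (metis inj_onD prod.inject snd_conv)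
    qed
    then show "\<forall>a\<in>Q. \<forall>a'\<in>Q. a \<noteq> a' \<longrightarrow> ?S a \<inter> ?S a' = {}" by blast
  qed
  moreover have "{E \<in> completions N j P u s. \<exists>a\<in>Q. (a, j) \<in> E} = (\<Union>a\<in>Q. ?S a)" by blast
  ultimately show ?thesis by simp
qed simp

text \<open>Position \<open>j\<close> is a singleton, an opener, or the closer of a pending arc: the
  counterpart of \<open>free_gf_rec\<close>.\<close>

lemma card_completions_rec:
  assumes "j \<le> N" "P \<subseteq> {..<j}" "finite P"
  shows "card (completions N j P u s) =
    (if s = 0 then 0 else card (completions N (Suc j) P u (s - 1))) +
    (if u = 0 then 0 else card (completions N (Suc j) (insert j P) (u - 1) s)) +
    (\<Sum>a\<in>P. card (after_closer N (Suc j) (P - {a}) a u s))"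
proof -
  let ?C = "completions N j P u s"
  let ?S = "{E \<in> ?C. j \<notin> fst ` E \<and> j \<notin> snd ` E}"
  let ?O = "{E \<in> ?C. j \<in> fst ` E}"
  let ?K = "{E \<in> ?C. \<exists>a\<in>P. (a, j) \<in> E}"
  have K: "j \<in> snd ` E \<longleftrightarrow> (\<exists>a\<in>P. (a, j) \<in> E)" if E: "E \<in> ?C" for E
  proof
    assume "j \<in> snd ` E"
    then obtain a where a: "(a, j) \<in> E" by force
    then have "a \<in> fst ` E" "a < j" using completionsD(7)[OF E] by force+
    moreover from this have "a \<in> P \<union> {j..N}" using completionsD(5)[OF E] by (metis subsetD)
    ultimately have "a \<in> P" by simp
    with a show "\<exists>a\<in>P. (a, j) \<in> E" by blast
  qed force
  have d: "\<not> (j \<in> fst ` E \<and> j \<in> snd ` E)" if E: "E \<in> ?C" for E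
    using completionsD(3)[OF E] by (metis IntI emptyE)
  have fin: "finite ?C" by (rule finite_completions[OF assms(3)])
  have "?C = (?S \<union> ?O) \<union> ?K" using K by blast
  then have "card ?C = card ((?S \<union> ?O) \<union> ?K)" by simp
  also have "\<dots> = card (?S \<union> ?O) + card ?K"
    using fin K d by (intro card_Un_disjoint) (auto simp del: image_iff)
  also have "card (?S \<union> ?O) = card ?S + card ?O"
    using fin by (intro card_Un_disjoint) auto
  finally show ?thesis
    unfolding completions_single[OF assms(1,2)] completions_opener[OF assms(1,2)]
    using card_closers[of j N P P u s] assms by simp
qed

text \<open>Position \<open>j\<close> is no closer, hence a singleton or an opener. The completions
  in which \<open>Suc j\<close> then closes an arc from \<open>Q\<close> are forbidden and are added
  back on the left, as in \<open>closed_gf_rec\<close>.\<close>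

lemma card_after_closer_rec:
  fixes i :: nat
  \<comment> \<open>The positions from \<open>j\<close> to \<open>N\<close> hold \<open>u\<close>
    openers, \<open>s\<close> singletons and \<open>u + card P\<close> closers.\<close>
  assumes "j \<le> N" "P \<subseteq> {..<j}" "finite P" and len: "N + 1 = j + 2 * u + s + card P"
  defines "Q \<equiv> {a \<in> P. i < a}"
  shows "card (after_closer N j P i u s) +
    (if s = 0 then 0 else \<Sum>a\<in>Q. card (after_closer N (Suc (Suc j)) (P - {a}) a u (s - 1))) +
    (if u = 0 then 0 else \<Sum>a\<in>Q. card (after_closer N (Suc (Suc j)) (insert j P - {a}) a (u - 1) s)) =
    (if s = 0 then 0 else card (completions N (Suc j) P u (s - 1))) +
    (if u = 0 then 0 else card (completions N (Suc j) (insert j P) (u - 1) s))"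
proof -
  let ?C = "completions N j P u s"
  let ?S = "{E \<in> ?C. j \<notin> fst ` E \<and> j \<notin> snd ` E}"
  let ?O = "{E \<in> ?C. j \<in> fst ` E}"
  let ?bad = "\<lambda>E. \<exists>a\<in>Q. (a, Suc j) \<in> E"
  have bad: "(\<forall>a. (a, Suc j) \<in> E \<longrightarrow> i < a \<longrightarrow> j \<le> a) \<longleftrightarrow> \<not> ?bad E" if E: "E \<in> ?C" for E
  proof -
    have "a \<in> P \<longleftrightarrow> a < j" if "(a, Suc j) \<in> E" for a
    proof -
      from that have "a \<in> fst ` E" by force
      then have "a \<in> P \<union> {j..N}" using completionsD(5)[OF E] by (metis subsetD)
      with assms(2) show ?thesis by auto
    qed
    then show ?thesis unfolding Q_def by (auto simp: not_le)
  qed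
  have d: "\<not> (j \<in> fst ` E \<and> j \<in> snd ` E)" if E: "E \<in> ?C" for E
    using completionsD(3)[OF E] by (metis IntI emptyE)
  have fin: "finite ?C" by (rule finite_completions[OF assms(3)])
  have split: "card {E \<in> X. \<not> ?bad E} + card {E \<in> X. ?bad E} = card X"
    if "finite X" for X
  proof -
    have "card ({E \<in> X. \<not> ?bad E} \<union> {E \<in> X. ?bad E}) = card {E \<in> X. \<not> ?bad E} + card {E \<in> X. ?bad E}"
      using that by (intro card_Un_disjoint) auto
    moreover have "{E \<in> X. \<not> ?bad E} \<union> {E \<in> X. ?bad E} = X" by blast
    ultimately show ?thesis by simp
  qed
  have "after_closer N j P i u s = {E \<in> ?S. \<not> ?bad E} \<union> {E \<in> ?O. \<not> ?bad E}"
    unfolding after_closer_def using bad d by blast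
  then have "card (after_closer N j P i u s) = card ({E \<in> ?S. \<not> ?bad E} \<union> {E \<in> ?O. \<not> ?bad E})"
    by simp
  also have "\<dots> = card {E \<in> ?S. \<not> ?bad E} + card {E \<in> ?O. \<not> ?bad E}"
    using fin by (intro card_Un_disjoint) auto
  finally have "card (after_closer N j P i u s) + card {E \<in> ?S. ?bad E} + card {E \<in> ?O. ?bad E} =
      card ?S + card ?O"
    using split[of ?S] split[of ?O] fin by simp
  moreover have "card {E \<in> ?S. ?bad E} = (if s = 0 then 0 else
      \<Sum>a\<in>Q. card (after_closer N (Suc (Suc j)) (P - {a}) a u (s - 1)))"
  proof (cases "s = 0")
    case False
    \<comment> \<open>A pending opener in \<open>Q\<close> needs a closer besides the singleton at
      \<open>j\<close>, so \<open>len\<close> leaves room for position \<open>Suc j\<close>.\<close>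
    have "Suc j \<le> N \<or> Q = {}"
    proof (rule disjCI)
      assume "Q \<noteq> {}"
      then have "card P > 0" using assms(3) by (auto simp: Q_def card_gt_0_iff)
      with len False show "Suc j \<le> N" by simp
    qed
    moreover have "P \<subseteq> {..<Suc j}" "Q \<subseteq> P" using assms(2) by (auto simp: Q_def)
    ultimately show ?thesis
      unfolding completions_single[OF assms(1,2)]
      using False card_closers[of "Suc j" N Q P u "s - 1"] assms(3) by simp
  qed (simp add: completions_single[OF assms(1,2)])
  moreover have "card {E \<in> ?O. ?bad E} = (if u = 0 then 0 else
      \<Sum>a\<in>Q. card (after_closer N (Suc (Suc j)) (insert j P - {a}) a (u - 1) s))"
  proof (cases "u = 0")
    case False
    then have "Suc j \<le> N" using len by simp
    moreover have "insert j P \<subseteq> {..<Suc j}" "Q \<subseteq> insert j P" using assms(2) by (auto simp: Q_def)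
    ultimately show ?thesis
      unfolding completions_opener[OF assms(1,2)]
      using False card_closers[of "Suc j" N Q "insert j P" "u - 1" s] assms(3) by simp
  qed (simp add: completions_opener[OF assms(1,2)])
  ultimately show ?thesis
    unfolding completions_single[OF assms(1,2)] completions_opener[OF assms(1,2)] by simp
qed

text \<open>The two counts call each other and the second looks two positions ahead, so both are
  proved together by strong induction on the number of remaining positions. Of \<open>P\<close> and
  \<open>i\<close>, only \<open>card P\<close> and \<open>rank P i\<close> matter.\<close>

lemma card_completions:
  assumes "finite P" "P \<subseteq> {..<j}" "N + 1 = j + 2 * u + s + card P" "u + s \<le> M"
  shows "int (card (completions N j P u s)) = bcoeff (free_gf qvar yvar M (card P)) u s \<and>
    (\<forall>i. i \<notin> P \<longrightarrow> int (card (after_closer N j P i u s)) =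
      bcoeff (closed_gf qvar yvar M (card P) (rank P i)) u s)"
  using assms
proof (induction "N + 1 - j" arbitrary: j P u s rule: less_induct)
  case less
  note P = less.prems(1,2) and len = less.prems(3) and M = less.prems(4)
  let ?p = "card P" and ?F = "free_gf qvar yvar M" and ?V = "closed_gf qvar yvar M"
  have err: "bcoeff (weight qvar yvar (Suc M) * R) u s = 0" for R
    using M by (intro bcoeff_weight) simp
  have F: "bcoeff (?F ?p) u s = bcoeff (0 ^ ?p) u s
      + (if u = 0 then 0 else bcoeff (?F (Suc ?p)) (u - 1) s)
      + (if s = 0 then 0 else bcoeff (?F ?p) u (s - 1)) + (\<Sum>r<?p. bcoeff (?V (?p - 1) r) u s)"
    using arg_cong[OF free_gf_rec[of qvar yvar M ?p], of "\<lambda>X. bcoeff X u s"]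
    by (simp only: err bcoeff_add bcoeff_sum bcoeff_qvar bcoeff_yvar add_0_right)
  have V: "bcoeff (?V ?p r) u s
      + (if u = 0 then 0 else \<Sum>x\<in>{r..<?p}. bcoeff (?V ?p x) (u - 1) s)
      + (if s = 0 then 0 else \<Sum>x\<in>{r..<?p}. bcoeff (?V (?p - 1) x) u (s - 1)) =
      bcoeff (0 ^ ?p) u s
      + (if u = 0 then 0 else bcoeff (?F (Suc ?p)) (u - 1) s)
      + (if s = 0 then 0 else bcoeff (?F ?p) u (s - 1))" if "r \<le> ?p" for r
    using arg_cong[OF closed_gf_rec[OF that, of qvar yvar M], of "\<lambda>X. bcoeff X u s"]
    by (simp only: err bcoeff_add bcoeff_sum bcoeff_qvar bcoeff_yvar add_0_right)
  show ?case
  proof (cases "j \<le> N")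
    case False
    then have z: "u = 0" "s = 0" "?p = 0" using len by simp_all
    with P have "P = {}" by simp
    with z False F V[of 0] show ?thesis
      by (simp add: completions_end rank_def)
  next
    case True
    \<comment> \<open>Positions remain, so either some arc is open and \<open>0 ^ ?p\<close>
      vanishes, or \<open>u + s\<close> is positive and the constant 1 does not contribute.\<close>
    have z: "bcoeff (0 ^ ?p) u s = 0"
      using True len by (cases ?p) auto
    have jP: "j \<notin> P" using P by auto
    have PS: "P \<subseteq> {..<Suc j}" "insert j P \<subseteq> {..<Suc j}" "P - {a} \<subseteq> {..<Suc j}"
      "P - {a} \<subseteq> {..<Suc (Suc j)}" "insert j P - {a} \<subseteq> {..<Suc (Suc j)}" for a
      using P by auto
    have S: "int (card (completions N (Suc j) P u (s - 1))) = bcoeff (?F ?p) u (s - 1)"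
      if "s \<noteq> 0"
      using less.hyps[of "Suc j" P u "s - 1"] that True PS P len M by simp
    have O: "int (card (completions N (Suc j) (insert j P) (u - 1) s)) =
        bcoeff (?F (Suc ?p)) (u - 1) s" if "u \<noteq> 0"
      using less.hyps[of "Suc j" "insert j P" "u - 1" s] that True PS P len M jP
      by (cases u) simp_all
    have K: "int (card (after_closer N (Suc j) (P - {a}) a u s)) =
        bcoeff (?V (?p - 1) (rank P a)) u s" if "a \<in> P" for a
    proof -
      have "?p > 0" using that P by (auto simp: card_gt_0_iff)
      then show ?thesis
        using less.hyps[of "Suc j" "P - {a}" u s] that True PS P len M
        by (simp add: rank_Diff_self)
    qed
    have SK: "int (card (after_closer N (Suc (Suc j)) (P - {a}) a u (s - 1))) =
        bcoeff (?V (?p - 1) (rank P a)) u (s - 1)" if "s \<noteq> 0" "a \<in> P" for a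
    proof -
      have "?p > 0" using that P by (auto simp: card_gt_0_iff)
      then show ?thesis
        using less.hyps[of "Suc (Suc j)" "P - {a}" u "s - 1"] that True PS P len M
        by (simp add: rank_Diff_self)
    qed
    have OK: "int (card (after_closer N (Suc (Suc j)) (insert j P - {a}) a (u - 1) s)) =
        bcoeff (?V ?p (rank P a)) (u - 1) s" if "u \<noteq> 0" "a \<in> P" for a
    proof -
      \<comment> \<open>The new opener \<open>j\<close> lies above \<open>a\<close>, so it leaves
        the rank of \<open>a\<close> alone, and it makes up for the closed \<open>a\<close> in the
        cardinality.\<close>
      have "rank (insert j P) a = rank P a" using P that by (intro rank_insert_above) auto
      moreover have "card (insert j P - {a}) = ?p" using P jP that by simp
      ultimately show ?thesis
        using less.hyps[of "Suc (Suc j)" "insert j P - {a}" "u - 1" s] that True PS P len M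
        by (cases u) (simp_all add: rank_Diff_self)
    qed
    have S': "int (if s = 0 then 0 else card (completions N (Suc j) P u (s - 1))) =
        (if s = 0 then 0 else bcoeff (?F ?p) u (s - 1))"
      using S by simp
    have O': "int (if u = 0 then 0 else card (completions N (Suc j) (insert j P) (u - 1) s)) =
        (if u = 0 then 0 else bcoeff (?F (Suc ?p)) (u - 1) s)"
      using O by simp
    have "int (\<Sum>a\<in>P. card (after_closer N (Suc j) (P - {a}) a u s)) =
        (\<Sum>a\<in>P. bcoeff (?V (?p - 1) (rank P a)) u s)"
      unfolding of_nat_sum by (rule sum.cong[OF refl K])
    then have K': "int (\<Sum>a\<in>P. card (after_closer N (Suc j) (P - {a}) a u s)) =
        (\<Sum>r<?p. bcoeff (?V (?p - 1) r) u s)"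
      unfolding sum_rank[OF P(1), of "\<lambda>r. bcoeff (?V (?p - 1) r) u s"] .
    have "int (card (completions N j P u s)) = bcoeff (?F ?p) u s"
      unfolding card_completions_rec[OF True P(2,1)] of_nat_add S' O' K' F z by linarith
    moreover have "int (card (after_closer N j P i u s)) = bcoeff (?V ?p (rank P i)) u s"
      if i: "i \<notin> P" for i
    proof -
      let ?Q = "{a \<in> P. i < a}"
      have "(\<Sum>a\<in>?Q. int (card (after_closer N (Suc (Suc j)) (P - {a}) a u (s - 1)))) =
          (\<Sum>a\<in>?Q. bcoeff (?V (?p - 1) (rank P a)) u (s - 1))" if "s \<noteq> 0"
        using SK[OF that] by (intro sum.cong) simp_all
      then have 1: "int (if s = 0 then 0
            else \<Sum>a\<in>?Q. card (after_closer N (Suc (Suc j)) (P - {a}) a u (s - 1))) =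
          (if s = 0 then 0 else \<Sum>x\<in>{rank P i..<?p}. bcoeff (?V (?p - 1) x) u (s - 1))"
        unfolding sum_rank_above[OF P(1) i, of "\<lambda>x. bcoeff (?V (?p - 1) x) u (s - 1)"] by simp
      have "(\<Sum>a\<in>?Q. int (card (after_closer N (Suc (Suc j)) (insert j P - {a}) a (u - 1) s))) =
          (\<Sum>a\<in>?Q. bcoeff (?V ?p (rank P a)) (u - 1) s)" if "u \<noteq> 0"
        using OK[OF that] by (intro sum.cong) simp_all
      then have 2: "int (if u = 0 then 0
            else \<Sum>a\<in>?Q. card (after_closer N (Suc (Suc j)) (insert j P - {a}) a (u - 1) s)) =
          (if u = 0 then 0 else \<Sum>x\<in>{rank P i..<?p}. bcoeff (?V ?p x) (u - 1) s)"
        unfolding sum_rank_above[OF P(1) i, of "\<lambda>x. bcoeff (?V ?p x) (u - 1) s"] by simp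
      note rec = arg_cong[OF card_after_closer_rec[OF True P(2,1) len, of i], of int]
      show ?thesis
        using rec V[OF rank_le_card[OF P(1)], of i] unfolding of_nat_add S' O' 1 2 z by linarith
    qed
    ultimately show ?thesis by blast
  qed
qed

section \<open>Matchings as sets of arcs\<close>

definition matching_of :: "nat \<Rightarrow> (nat \<times> nat) set \<Rightarrow> nat set set" where
  "matching_of N E = (\<lambda>(a, b). {a, b}) ` E \<union> (\<lambda>x. {x}) ` ({1..N} - fst ` E - snd ` E)"

lemma matching_of_cases:
  assumes "B \<in> matching_of N E"
  obtains (pair) a b where "B = {a, b}" "(a, b) \<in> E"
    | (single) x where "B = {x}" "x \<in> {1..N} - fst ` E - snd ` E"
proof -
  from assms consider p where "p \<in> E" "B = (\<lambda>(a, b). {a, b}) p"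
    | x where "x \<in> {1..N} - fst ` E - snd ` E" "B = {x}"
    unfolding matching_of_def by blast
  then show ?thesis
  proof cases
    case 1
    then show ?thesis using pair[of "fst p" "snd p"] by (simp add: case_prod_unfold)
  next
    case 2
    then show ?thesis by (intro single[of x])
  qed
qed

text \<open>The orientation \<open>a < b\<close> recovers an arc from its unordered block.\<close>

lemma arcs_matching_of:
  assumes "\<forall>(a, b)\<in>E. a < b"
  shows "arcs (matching_of N E) = E"
proof -
  have "(i, j) \<in> arcs (matching_of N E) \<longleftrightarrow> (i, j) \<in> E" for i j
  proof
    assume "(i, j) \<in> arcs (matching_of N E)"
    then have ij: "i < j" "{i, j} \<in> matching_of N E" by (auto simp: arcs_def)
    from ij(2) show "(i, j) \<in> E"
    proof (cases rule: matching_of_cases)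
      case (pair a b)
      with assms have "a < b" by blast
      with pair ij(1) show ?thesis by (auto simp: doubleton_eq_iff)
    next
      case (single x)
      then have "i = j" by (metis insertI1 insertI2 singletonD)
      with ij(1) show ?thesis by simp
    qed
  next
    assume E: "(i, j) \<in> E"
    then have "(\<lambda>(a, b). {a, b}) (i, j) \<in> matching_of N E" unfolding matching_of_def by blast
    moreover have "i < j" using E assms by blast
    ultimately show "(i, j) \<in> arcs (matching_of N E)" by (simp add: arcs_def)
  qed
  then show ?thesis by auto
qed

context
  fixes N :: nat and M :: "nat set set"
  assumes M: "partial_matching N M"
begin

lemma matching_block_eq: "A \<in> M \<Longrightarrow> B \<in> M \<Longrightarrow> x \<in> A \<Longrightarrow> x \<in> B \<Longrightarrow> A = B"
  using M unfolding partial_matching_def partition_on_def disjoint_def by blast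

lemma arcsD:
  assumes "(a, b) \<in> arcs M"
  shows "a < b" "{a, b} \<in> M" "a \<in> {1..N}" "b \<in> {1..N}"
proof -
  show *: "a < b" "{a, b} \<in> M" using assms by (auto simp: arcs_def)
  have "\<Union>M = {1..N}" using M by (simp add: partial_matching_def partition_on_def)
  with *(2) show "a \<in> {1..N}" "b \<in> {1..N}" by blast+
qed

lemma arcs_common_point:
  assumes "(a, b) \<in> arcs M" "(c, d) \<in> arcs M" "{a, b} \<inter> {c, d} \<noteq> {}"
  shows "a = c \<and> b = d"
proof -
  have "{a, b} = {c, d}"
    using assms(3) arcsD(2)[OF assms(1)] arcsD(2)[OF assms(2)] matching_block_eq by blast
  then show ?thesis
    using arcsD(1)[OF assms(1)] arcsD(1)[OF assms(2)] by (auto simp: doubleton_eq_iff)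
qed

lemma arcs_inj: "inj_on fst (arcs M)" "inj_on snd (arcs M)"
  and arcs_disjoint: "fst ` arcs M \<inter> snd ` arcs M = {}"
proof -
  have eq: "p = p'" if "p \<in> arcs M" "p' \<in> arcs M" "{fst p, snd p} \<inter> {fst p', snd p'} \<noteq> {}" for p p'
    using arcs_common_point[of "fst p" "snd p" "fst p'" "snd p'"] that by (simp add: prod_eq_iff)
  show "inj_on fst (arcs M)" "inj_on snd (arcs M)"
    by (rule inj_onI, rule eq; simp)+
  show "fst ` arcs M \<inter> snd ` arcs M = {}"
  proof (rule ccontr)
    assume "fst ` arcs M \<inter> snd ` arcs M \<noteq> {}"
    then obtain p p' where p: "p \<in> arcs M" "p' \<in> arcs M" "fst p = snd p'" by blast
    then have "p = p'" by (intro eq) simp_all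
    moreover have "fst p < snd p" using p(1) by (intro arcsD(1)) simp
    ultimately show False using p(3) by simp
  qed
qed

text \<open>Closers at distance 1 give a crossing or a right nesting, depending on the order of the
  openers; closers at distance 2 matter only for crossings.\<close>

lemma right_avoiding_arcs_iff:
  "right_avoiding (arcs M) \<longleftrightarrow> \<not> has_2_right_crossing M \<and> \<not> has_right_nesting M"
proof
  assume "right_avoiding (arcs M)"
  then have g1: "\<And>a b a'. (a, b) \<in> arcs M \<Longrightarrow> (a', Suc b) \<notin> arcs M"
    and g2: "\<And>a b a'. (a, b) \<in> arcs M \<Longrightarrow> (a', Suc (Suc b)) \<in> arcs M \<Longrightarrow> a < a' \<Longrightarrow> b \<le> a'"
    unfolding right_avoiding_def by blast+
  have "\<not> has_2_right_crossing M"
  proof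
    assume "has_2_right_crossing M"
    then obtain i1 j1 i2 j2 where c: "(i1, j1) \<in> arcs M" "(i2, j2) \<in> arcs M"
      "i1 < i2" "i2 < j1" "j1 < j2" "j2 - j1 \<le> 2"
      unfolding has_2_right_crossing_def by blast
    then consider "j2 = Suc j1" | "j2 = Suc (Suc j1)" by linarith
    then show False
    proof cases
      case 1
      then show False using g1[OF c(1)] c(2) by simp
    next
      case 2
      then show False using g2[OF c(1)] c(2-4) by fastforce
    qed
  qed
  moreover have "\<not> has_right_nesting M"
    unfolding has_right_nesting_def Suc_eq_plus1[symmetric] using g1 by blast
  ultimately show "\<not> has_2_right_crossing M \<and> \<not> has_right_nesting M" by blast
next
  assume n: "\<not> has_2_right_crossing M \<and> \<not> has_right_nesting M"
  show "right_avoiding (arcs M)"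
    unfolding right_avoiding_def
  proof (intro conjI allI impI notI)
    fix a b a' assume E: "(a, b) \<in> arcs M" "(a', Suc b) \<in> arcs M"
    note lt = arcsD(1)[OF E(1)] arcsD(1)[OF E(2)]
    \<comment> \<open>Distinct arcs share no point, so \<open>a' < a\<close> or
      \<open>a < a'\<close>, and in the latter case \<open>a'\<close> lies strictly inside the first
      arc.\<close>
    have ne: "a' \<noteq> a" "a' \<noteq> b" using arcs_common_point[OF E] by auto
    show False
    proof (cases "a < a'")
      case True
      with lt ne have "a' < b" by simp
      moreover have "b < Suc b" "Suc b - b \<le> 2" by simp_all
      ultimately show False using True E n unfolding has_2_right_crossing_def by blast
    next
      case False
      with ne have "a' < a" by simp
      moreover have "b < Suc b" "Suc b = b + 1" by simp_all
      ultimately show False using lt(1) E n unfolding has_right_nesting_def by blast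
    qed
  next
    fix a b a' assume E: "(a, b) \<in> arcs M" "(a', Suc (Suc b)) \<in> arcs M" "a < a'"
    show "b \<le> a'"
    proof (rule ccontr)
      assume "\<not> b \<le> a'"
      then have "a' < b" by simp
      moreover have "b < Suc (Suc b)" "Suc (Suc b) - b \<le> 2" by simp_all
      ultimately show False using E n unfolding has_2_right_crossing_def by blast
    qed
  qed
qed

text \<open>A block of size two is an arc; hence a point on no arc can only lie in a singleton
  block.\<close>

lemma matching_of_arcs: "matching_of N (arcs M) = M"
proof -
  have part: "\<Union>M = {1..N}" "{} \<notin> M" and le: "\<And>B. B \<in> M \<Longrightarrow> card B \<le> 2"
    using M by (auto simp: partial_matching_def partition_on_def)
  have fin: "finite B" if "B \<in> M" for B
  proof (rule finite_subset)
    show "B \<subseteq> {1..N}" using that part(1) by blast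
  qed simp
  have pair: "(x, y) \<in> arcs M \<or> (y, x) \<in> arcs M" if "B \<in> M" "y \<noteq> x" "B = {x, y}" for B x y
    using that by (cases x y rule: linorder_cases) (simp_all add: arcs_def insert_commute)
  have sing: "{x} \<in> M" if x: "x \<in> {1..N}" "x \<notin> fst ` arcs M" "x \<notin> snd ` arcs M" for x
  proof -
    have "x \<in> \<Union>M" using x(1) part(1) by simp
    then obtain B where B: "B \<in> M" "x \<in> B" by (rule UnionE)
    have "finite B" using fin B(1) .
    have "y = x" if y: "y \<in> B" for y
    proof (rule ccontr)
      assume ne: "y \<noteq> x"
      have "{x, y} = B"
      proof (rule card_seteq[OF \<open>finite B\<close>])
        show "{x, y} \<subseteq> B" using y B(2) by simp
        show "card B \<le> card {x, y}" using le[OF B(1)] ne by simp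
      qed
      then have "B = {x, y}" by (rule sym)
      with B(1) have "(x, y) \<in> arcs M \<or> (y, x) \<in> arcs M" by (rule pair[OF _ ne])
      then have "x \<in> fst ` arcs M \<or> x \<in> snd ` arcs M" by (metis fst_conv snd_conv image_eqI)
      with x(2,3) show False by simp
    qed
    with B have "B = {x}" by blast
    with B show ?thesis by simp
  qed
  have "B \<in> matching_of N (arcs M)" if B: "B \<in> M" for B
  proof -
    have "finite B" using fin B .
    moreover have "B \<noteq> {}" using B part(2) by blast
    ultimately have "card B \<noteq> 0" by simp
    then have "card B = 1 \<or> card B = 2" using le[OF B] by linarith
    then show ?thesis
    proof
      assume "card B = 1"
      then obtain x where x: "B = {x}" by (rule card_1_singletonE)
      have "x \<in> {1..N}" using part(1) B x by blast
      moreover have "x \<noteq> fst p \<and> x \<noteq> snd p" if "p \<in> arcs M" for p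
      proof -
        have p: "fst p < snd p" "{fst p, snd p} \<in> M"
          using arcsD(1,2)[of "fst p" "snd p"] that by simp_all
        have "x \<notin> {fst p, snd p}"
        proof
          assume "x \<in> {fst p, snd p}"
          then have "B = {fst p, snd p}" using x by (intro matching_block_eq[OF B p(2)]) simp_all
          then have "fst p = x" "snd p = x" unfolding x by (metis insertI1 insertI2 singletonD)+
          with p(1) show False by simp
        qed
        then show ?thesis by simp
      qed
      then have "x \<notin> fst ` arcs M" "x \<notin> snd ` arcs M" by blast+
      ultimately show ?thesis unfolding matching_of_def x by blast
    next
      assume "card B = 2"
      then obtain x y where xy: "B = {x, y}" "x \<noteq> y" unfolding card_2_iff by blast
      have "(x, y) \<in> arcs M \<or> (y, x) \<in> arcs M" by (rule pair[OF B xy(2)[symmetric] xy(1)])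
      then have "B \<in> (\<lambda>(a, b). {a, b}) ` arcs M"
      proof
        assume "(x, y) \<in> arcs M"
        then show ?thesis by (rule rev_image_eqI) (simp add: xy(1))
      next
        assume "(y, x) \<in> arcs M"
        then show ?thesis by (rule rev_image_eqI) (simp add: xy(1) insert_commute)
      qed
      then show ?thesis unfolding matching_of_def by blast
    qed
  qed
  moreover have "B \<in> M" if "B \<in> matching_of N (arcs M)" for B
  proof -
    from that consider a b where "B = {a, b}" "(a, b) \<in> arcs M"
      | x where "B = {x}" "x \<in> {1..N} - fst ` arcs M - snd ` arcs M"
      by (rule matching_of_cases)
    then show ?thesis
    proof cases
      case 1
      then show ?thesis using arcsD(2) by simp
    next
      case 2
      show ?thesis unfolding 2(1) by (rule sing) (use 2(2) in \<open>blast+\<close>)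
    qed
  qed
  ultimately show ?thesis by blast
qed

lemma arcs_in_completions:
  assumes "\<not> has_2_right_crossing M" "\<not> has_right_nesting M"
  shows "arcs M \<in> completions N 1 {} (card (arcs M)) (N - 2 * card (arcs M))"
proof -
  have sub: "fst ` arcs M \<subseteq> {1..N}" "snd ` arcs M \<subseteq> {1..N}"
    using arcsD(3,4) by force+
  have "card ({1..N} - (fst ` arcs M \<union> snd ` arcs M)) = N - 2 * card (arcs M)"
    using sub arcs_inj arcs_disjoint finite_subset[OF sub(1)] finite_subset[OF sub(2)]
    by (subst card_Diff_subset) (simp_all add: card_Un_disjoint card_image)
  then show ?thesis
    using sub arcs_inj arcs_disjoint arcsD(1) right_avoiding_arcs_iff assms
    by (simp add: completions_def card_image Diff_eq Int_assoc case_prod_unfold)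
qed

end

lemma partial_matching_matching_of:
  assumes "inj_on fst E" "inj_on snd E" "fst ` E \<inter> snd ` E = {}"
    "fst ` E \<subseteq> {1..N}" "snd ` E \<subseteq> {1..N}"
  shows "partial_matching N (matching_of N E)"
proof -
  let ?S = "{1..N} - fst ` E - snd ` E"
  have mem: "a \<in> fst ` E" "b \<in> snd ` E" if "(a, b) \<in> E" for a b using that by force+
  have "(\<Union>p\<in>E. {fst p, snd p}) = fst ` E \<union> snd ` E" by blast
  then have "\<Union>(matching_of N E) = fst ` E \<union> snd ` E \<union> ?S"
    by (simp add: matching_of_def case_prod_unfold)
  also have "\<dots> = {1..N}" using assms(4,5) by blast
  finally have U: "\<Union>(matching_of N E) = {1..N}" .
  have eq: "a = c \<and> b = d" if E: "(a, b) \<in> E" "(c, d) \<in> E" and x: "x \<in> {a, b}" "x \<in> {c, d}"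
    for a b c d x
  proof -
    have "a \<noteq> d" "b \<noteq> c" using mem[OF E(1)] mem[OF E(2)] assms(3) by (metis IntI emptyE)+
    with x consider "a = c" | "b = d" by auto
    then have "(a, b) = (c, d)"
    proof cases
      case 1
      then show ?thesis by (intro inj_onD[OF assms(1) _ E]) simp
    next
      case 2
      then show ?thesis by (intro inj_onD[OF assms(2) _ E]) simp
    qed
    then show ?thesis by simp
  qed
  have "disjoint (matching_of N E)"
    unfolding disjoint_def
  proof (intro ballI impI, rule ccontr)
    fix A B assume A: "A \<in> matching_of N E" and B: "B \<in> matching_of N E"
      and "A \<noteq> B" "A \<inter> B \<noteq> {}"
    then obtain x where x: "x \<in> A" "x \<in> B" by blast
    have notin: "x \<notin> fst ` E \<and> x \<notin> snd ` E" if "x \<in> {y}" "y \<in> ?S" for y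
      using that by simp
    have inE: "x \<in> fst ` E \<or> x \<in> snd ` E" if "x \<in> {a, b}" "(a, b) \<in> E" for a b
      using that mem by blast
    from A show False
    proof (cases rule: matching_of_cases)
      case A: (pair a b)
      from B show False
      proof (cases rule: matching_of_cases)
        case (pair c d)
        with eq[OF A(2) pair(2), of x] x A \<open>A \<noteq> B\<close> show False by simp
      next
        case (single y)
        then show False using notin inE A x by metis
      qed
    next
      case A: (single y)
      from B show False
      proof (cases rule: matching_of_cases)
        case (pair c d)
        then show False using notin inE A x by metis
      next
        case (single z)
        with A x \<open>A \<noteq> B\<close> show False by simp
      qed
    qed
  qed
  moreover have "{} \<notin> matching_of N E" unfolding matching_of_def by auto
  moreover have "card B \<le> 2" if "B \<in> matching_of N E" for B
    using that by (cases rule: matching_of_cases) (simp_all add: card_insert_if)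
  ultimately show ?thesis using U by (simp add: partial_matching_def partition_on_def)
qed

text \<open>At position 1 nothing is pending, so \<open>u\<close> counts all \<open>k\<close> arcs,
  and these leave \<open>N - 2 * k\<close> points as singletons.\<close>

lemma bij_betw_arcs:
  "bij_betw arcs (restricted_matchings N k) (completions N 1 {} k (N - 2 * k))"
proof (rule bij_betw_byWitness[where f' = "matching_of N"])
  show "\<forall>M\<in>restricted_matchings N k. matching_of N (arcs M) = M"
    by (simp add: restricted_matchings_def matching_of_arcs)
  show "\<forall>E\<in>completions N 1 {} k (N - 2 * k). arcs (matching_of N E) = E"
    by (rule ballI) (rule arcs_matching_of[OF completionsD(7)])
  show "arcs ` restricted_matchings N k \<subseteq> completions N 1 {} k (N - 2 * k)"
    using arcs_in_completions by (auto simp: restricted_matchings_def)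
  show "matching_of N ` completions N 1 {} k (N - 2 * k) \<subseteq> restricted_matchings N k"
  proof clarify
    fix E assume E: "E \<in> completions N 1 {} k (N - 2 * k)"
    note D = completionsD[OF E]
    have pm: "partial_matching N (matching_of N E)"
      using D(1,2,3,5,6) by (intro partial_matching_matching_of) simp_all
    moreover have "arcs (matching_of N E) = E" by (rule arcs_matching_of[OF D(7)])
    moreover have "card E = k" using D(1,9) by (simp add: card_image)
    ultimately show "matching_of N E \<in> restricted_matchings N k"
      using right_avoiding_arcs_iff[OF pm] D(8) by (simp add: restricted_matchings_def)
  qed
qed

theorem theorem2p2:
  fixes n k :: nat
  assumes "n \<ge> 1" and "k \<le> n - 1"
  shows "\<exists>f. bij_betw f (restricted_matchings (n + k - 1) k) (restricted_sequences n k)"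
proof -
  \<comment> \<open>The number \<open>s\<close> is both the number of singletons and the number of
    left-to-right maxima after the first entry.\<close>
  define N s where "N = n + k - 1" and "s = n - 1 - k"
  have N: "N - 2 * k = s" "N + 1 = 1 + 2 * k + s + card ({} :: nat set)"
    using assms by (auto simp: N_def s_def)
  \<comment> \<open>The cut-off \<open>k + s\<close> is the total degree of the coefficient wanted,
    so the truncated series still gives it exactly.\<close>
  have "int (card (completions N 1 {} k s)) = bcoeff (free_gf qvar yvar (k + s) 0) k s"
    using card_completions[of "{}" 1 N k s "k + s"] N by simp
  also have "\<dots> = int (card (continuations 0 0 k s))"
    using card_continuations[of 0 0 k s "k + s"] by (simp add: free_gf_0_eq_seq_gf)
  also have "\<dots> = int (card (restricted_sequences n k))"
    by (simp add: restricted_sequences_eq[OF assms] s_def card_image)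
  finally have "card (completions N 1 {} k s) = card (restricted_sequences n k)" by simp
  moreover have "finite (completions N 1 {} k s)" by (simp add: finite_completions)
  moreover have "finite (restricted_sequences n k)"
    using card_continuations[of 0 0 k s "k + s"] by (simp add: restricted_sequences_eq[OF assms] s_def)
  ultimately obtain g where "bij_betw g (completions N 1 {} k s) (restricted_sequences n k)"
    using finite_same_card_bij by blast
  then show ?thesis
    using bij_betw_trans[OF bij_betw_arcs[of N k, unfolded N(1)]] unfolding N_def by blast
qed

end
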